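(* For any $n\ge 1$ and $k>0$ (integers) there are only finitely many families of quasi smooth hypersurfaces $X\subset\mathbb{P}(a_0,\dots,a_n)$ such that $\omega_X\cong\mathcal{O}_X(k)$. That is, there are only finitely many $(n+1)$-tuples of positive integers $(a_0,\dots,a_n)$, any $n$ of which are relatively prime, such that $\mathbb{P}(a_0,\dots,a_n)$ contains a quasi smooth hypersurface of degree $d=a_0+\cdots+a_n+k$.
   Context: Work over $\mathbb{C}$. $\mathbb{P}(a_0,\dots,a_n)$ is the weighted projective $n$-space with coordinates $x_0,\dots,x_n$, $\deg x_i=a_i$. A hypersurface of degree $d$ is the zero set $(F=0)$ of a nonzero weighted homogeneous polynomial of weighted degree $d$. It is quasi smooth if it is smooth in the orbifold sense, i.e. the affine cone $(F=0)\subset\mathbb{C}^{n+1}$ is smooth away from the origin. The canonical sheaf is computed by the adjunction formula $\omega_X\cong\mathcal{O}_X(d-(a_0+\cdots+a_n))$ (valid if $X$ contains no codimension $2$ singular subset of the weighted projective space), so $\omega_X\cong\mathcal{O}_X(k)$ means $d=a_0+\cdots+a_n+k$. A family is given by the weights and the degree. *)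

theory Defs
  imports Complex_Main "HOL-Library.Poly_Mapping"
begin

text \<open>A polynomial in the variables \<open>x\<^sub>0, x\<^sub>1, \<dots>\<close> is a finitely supported map from exponent
  vectors to coefficients. A point is a function on indices; for a polynomial in
  \<open>x\<^sub>0, \<dots>, x\<^sub>n\<close> only its values at \<open>0, \<dots>, n\<close> matter.\<close>

type_synonym 'a polynomial = "(nat \<Rightarrow>\<^sub>0 nat) \<Rightarrow>\<^sub>0 'a"

definition in_variables :: "nat \<Rightarrow> 'a::zero polynomial \<Rightarrow> bool" where
  "in_variables N F \<longleftrightarrow> (\<forall>m \<in> Poly_Mapping.keys F. Poly_Mapping.keys m \<subseteq> {..<N})"

definition eval_poly :: "'a::comm_semiring_1 polynomial \<Rightarrow> (nat \<Rightarrow> 'a) \<Rightarrow> 'a" where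
  "eval_poly F x = (\<Sum>m \<in> Poly_Mapping.keys F.
     Poly_Mapping.lookup F m * (\<Prod>i \<in> Poly_Mapping.keys m. x i ^ Poly_Mapping.lookup m i))"

text \<open>Subtraction of exponents truncates, but only in terms whose coefficient is zero.\<close>

definition partial_deriv :: "nat \<Rightarrow> 'a::comm_semiring_1 polynomial \<Rightarrow> 'a polynomial" where
  "partial_deriv i F = (\<Sum>m \<in> Poly_Mapping.keys F.
     Poly_Mapping.single (m - Poly_Mapping.single i 1)
       (of_nat (Poly_Mapping.lookup m i) * Poly_Mapping.lookup F m))"

definition weighted_homogeneous :: "nat list \<Rightarrow> nat \<Rightarrow> 'a::zero polynomial \<Rightarrow> bool" where
  "weighted_homogeneous a d F \<longleftrightarrow> in_variables (length a) F \<and>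
     (\<forall>m \<in> Poly_Mapping.keys F. (\<Sum>i \<in> Poly_Mapping.keys m. a ! i * Poly_Mapping.lookup m i) = d)"

text \<open>Smoothness of the affine cone \<open>(F = 0)\<close> away from the origin is meant scheme-theoretically,
  i.e. by the Jacobian criterion for the equation \<open>F\<close>. (Smoothness of the reduced zero set would
  allow \<open>F\<close> to be, say, a power of a variable.)\<close>

definition smooth_away_from_origin :: "nat \<Rightarrow> complex polynomial \<Rightarrow> bool" where
  "smooth_away_from_origin N F \<longleftrightarrow>
     (\<forall>x. (\<exists>i<N. x i \<noteq> 0) \<and> eval_poly F x = 0 \<longrightarrow> (\<exists>i<N. eval_poly (partial_deriv i F) x \<noteq> 0))"

text \<open>The weighted projective space \<open>P(a\<^sub>0, \<dots>, a\<^sub>n)\<close> is given by the list of its weights.\<close>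

definition contains_quasi_smooth_hypersurface :: "nat list \<Rightarrow> nat \<Rightarrow> bool" where
  "contains_quasi_smooth_hypersurface a d \<longleftrightarrow>
     (\<exists>F :: complex polynomial. F \<noteq> 0 \<and> weighted_homogeneous a d F \<and>
        smooth_away_from_origin (length a) F)"

text \<open>Any \<open>length a - 1\<close> of the entries have greatest common divisor \<open>1\<close> (they need not be
  pairwise coprime).\<close>

definition well_formed_weights :: "nat list \<Rightarrow> bool" where
  "well_formed_weights a \<longleftrightarrow> (\<forall>i<length a. Gcd {a ! j |j. j < length a \<and> j \<noteq> i} = 1)"

end

theory Submission
  imports Defs "HOL-Analysis.Analysis"
begin

text \<open>Let \<open>F\<close> be a quasi smooth polynomial of degree \<open>d\<close> for weights with sum \<open>A < d\<close>. Then the weights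
  are optimal for the monomials of \<open>F\<close>: every \<open>w \<ge> 0\<close> for which all these monomials have weight at
  least \<open>d\<close> has sum at least \<open>A\<close>. (This is the statement that the log canonical threshold \<open>A / d\<close> of \<open>F\<close>
  is at most that of the ideal generated by its monomials.) To see it, measure the set of real points
  of the unit cube where \<open>\<bar>F\<bar> \<le> \<epsilon>\<^sup>d\<close>. It contains the box \<open>\<bar>x\<^sub>i\<bar> \<le> \<epsilon> powr w\<^sub>i\<close> (up to
  constants), so its volume is at least of order \<open>\<epsilon> powr (\<Sum>i. w\<^sub>i)\<close>. On the
  other hand it has volume of order at most \<open>\<epsilon>\<^sup>A\<close>: decompose the cube into weighted dyadic annuli, which
  are dilates of a single compact set on which \<open>F\<close> has no singular zero.

  Hence \<open>A / d\<close> is the value of a linear program in \<open>N\<close> variables, and by Helly's theorem at most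
  \<open>N + 1\<close> of the monomials determine it. If there were infinitely many weights, then \<open>A / (A + k)\<close> would
  increase strictly along a sequence of them, while by Dickson's lemma some \<open>(N + 1)\<close>-tuple of
  exponent vectors in it is dominated by a later one, which forces the later value to be at most the
  earlier one.\<close>

subsection \<open>Evaluation of polynomials\<close>

lemma eval_poly_superset:
  assumes "finite S" "Poly_Mapping.keys F \<subseteq> S"
  shows "eval_poly F x = (\<Sum>m\<in>S. Poly_Mapping.lookup F m *
           (\<Prod>i \<in> Poly_Mapping.keys m. x i ^ Poly_Mapping.lookup m i))"
  unfolding eval_poly_def
  by (rule sum.mono_neutral_left) (use assms in \<open>auto simp: in_keys_iff\<close>)

lemma eval_poly_zero: "eval_poly 0 x = 0"
  by (simp add: eval_poly_def)

lemma eval_poly_add: "eval_poly (F + G) x = eval_poly F x + eval_poly G x"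
proof -
  let ?S = "Poly_Mapping.keys F \<union> Poly_Mapping.keys G"
  have "Poly_Mapping.keys (F + G) \<subseteq> ?S"
    by (rule Poly_Mapping.keys_add)
  then show ?thesis
    by (subst (1 2 3) eval_poly_superset[where S = ?S])
       (auto simp: lookup_add distrib_right sum.distrib)
qed

lemma eval_poly_sum: "eval_poly (\<Sum>j\<in>J. G j) x = (\<Sum>j\<in>J. eval_poly (G j) x)"
  by (induction J rule: infinite_finite_induct) (simp_all add: eval_poly_zero eval_poly_add)

lemma eval_poly_single:
  "eval_poly (Poly_Mapping.single m c) x =
     c * (\<Prod>i \<in> Poly_Mapping.keys m. x i ^ Poly_Mapping.lookup m i)"
  by (subst eval_poly_superset[where S = "{m}"]) auto

text \<open>Indices outside \<open>keys m\<close> are covered as well: the exponent there is 0 and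
  the factor 1.\<close>

lemma monomial_split:
  fixes x :: "nat \<Rightarrow> 'a::comm_semiring_1"
  shows "(\<Prod>j \<in> Poly_Mapping.keys m. x j ^ Poly_Mapping.lookup m j) =
     x i ^ Poly_Mapping.lookup m i * (\<Prod>j \<in> Poly_Mapping.keys m - {i}. x j ^ Poly_Mapping.lookup m j)"
  by (cases "i \<in> Poly_Mapping.keys m") (auto simp: prod.remove in_keys_iff)

lemma monomial_lower:
  fixes x :: "nat \<Rightarrow> 'a::comm_semiring_1"
  shows "(\<Prod>j \<in> Poly_Mapping.keys (m - Poly_Mapping.single i 1).
            x j ^ Poly_Mapping.lookup (m - Poly_Mapping.single i 1) j) =
     x i ^ (Poly_Mapping.lookup m i - 1) *
     (\<Prod>j \<in> Poly_Mapping.keys m - {i}. x j ^ Poly_Mapping.lookup m j)"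
proof -
  have "Poly_Mapping.keys (m - Poly_Mapping.single i 1) - {i} = Poly_Mapping.keys m - {i}"
    by (auto simp: in_keys_iff lookup_minus lookup_single when_def split: if_splits)
  then show ?thesis
    by (subst monomial_split[where i = i])
       (auto simp: lookup_minus lookup_single when_def intro!: prod.cong)
qed

text \<open>Freezing the other variables turns \<open>F\<close> into a polynomial in
  \<open>t\<close>, differentiated term by term. This ties the formal derivatives of the Jacobian
  criterion to analytic estimates for \<open>F\<close>.\<close>

lemma has_field_derivative_eval_poly:
  fixes x :: "nat \<Rightarrow> 'a::real_normed_field"
  shows "((\<lambda>t. eval_poly F (x(i := t))) has_field_derivative
           eval_poly (partial_deriv i F) (x(i := t))) (at t within T)"
proof -
  let ?P = "\<lambda>m. \<Prod>j \<in> Poly_Mapping.keys m - {i}. x j ^ Poly_Mapping.lookup m j"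
  have P: "(\<Prod>j \<in> Poly_Mapping.keys m - {i}. (x(i := s)) j ^ Poly_Mapping.lookup m j) = ?P m" for m s
    by (rule prod.cong) auto
  have F: "eval_poly F (x(i := s)) = (\<Sum>m\<in>Poly_Mapping.keys F. Poly_Mapping.lookup F m *
       (s ^ Poly_Mapping.lookup m i * ?P m))" for s
    unfolding eval_poly_def by (subst monomial_split[where i = i]) (simp add: P)
  have D: "eval_poly (partial_deriv i F) (x(i := t)) = (\<Sum>m\<in>Poly_Mapping.keys F.
       Poly_Mapping.lookup F m * (of_nat (Poly_Mapping.lookup m i) * t ^ (Poly_Mapping.lookup m i - 1) * ?P m))"
    unfolding partial_deriv_def eval_poly_sum eval_poly_single
    by (subst monomial_lower) (auto simp: P intro!: sum.cong)
  show ?thesis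
    unfolding F D
    by (auto intro!: derivative_eq_intros sum.cong)
qed

lemma continuous_on_eval_poly_of_real:
  "continuous_on S (\<lambda>x :: nat \<Rightarrow> real. eval_poly F (\<lambda>i. of_real (x i) :: complex))"
proof -
  have "continuous_on UNIV (\<lambda>x :: nat \<Rightarrow> real. eval_poly F (\<lambda>i. of_real (x i) :: complex))"
    unfolding eval_poly_def by (intro continuous_intros continuous_on_product_coordinates)
  then show ?thesis
    by (rule continuous_on_subset) auto
qed

lemma borel_measurable_eval_poly_of_real:
  assumes "in_variables N F"
  shows "(\<lambda>x :: nat \<Rightarrow> real. eval_poly F (\<lambda>i. of_real (x i) :: complex))
           \<in> borel_measurable (PiM {..<N} (\<lambda>_. lborel))"
  unfolding eval_poly_def
proof (intro borel_measurable_sum borel_measurable_times borel_measurable_const borel_measurable_prod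
    borel_measurable_power)
  fix m i assume "m \<in> Poly_Mapping.keys F" "i \<in> Poly_Mapping.keys m"
  then have "i \<in> {..<N}"
    using assms by (auto simp: in_variables_def)
  then have "(\<lambda>x. x i) \<in> borel_measurable (PiM {..<N} (\<lambda>_. lborel :: real measure))"
    using measurable_component_singleton[of i "{..<N}" "\<lambda>_. lborel :: real measure"] by simp
  then show "(\<lambda>x. complex_of_real (x i)) \<in> borel_measurable (PiM {..<N} (\<lambda>_. lborel))"
    by measurable
qed

lemma eval_poly_cong:
  assumes "in_variables N F" "\<And>i. i < N \<Longrightarrow> x i = y i"
  shows "eval_poly F x = eval_poly F y"
  unfolding eval_poly_def
  by (intro sum.cong arg_cong2[where f = "(*)"] prod.cong refl)
     (use assms in \<open>auto simp: in_variables_def subset_iff\<close>)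

text \<open>Each monomial picks up the factor \<open>s ^ d\<close>. With \<open>s = 1/2\<close> this
  is the dilation that relates the weighted dyadic annuli to each other.\<close>

lemma eval_poly_weighted_scale:
  assumes F: "weighted_homogeneous a d F"
  shows "eval_poly F (\<lambda>i. s ^ (a ! i) * x i) = s ^ d * eval_poly F x"
proof -
  have "(\<Prod>i \<in> Poly_Mapping.keys m. (s ^ (a ! i) * x i) ^ Poly_Mapping.lookup m i)
      = s ^ d * (\<Prod>i \<in> Poly_Mapping.keys m. x i ^ Poly_Mapping.lookup m i)"
    if "m \<in> Poly_Mapping.keys F" for m
    using F that
    by (simp add: weighted_homogeneous_def power_mult_distrib prod.distrib flip: power_mult power_sum)
  then show ?thesis
    unfolding eval_poly_def sum_distrib_left by (auto intro!: sum.cong simp: mult_ac)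
qed

subsection \<open>Volumes of sublevel sets\<close>

text \<open>Change of variables for a diagonal map, one coordinate at a time by Tonelli and the
  substitution rule on the line.\<close>

lemma nn_integral_PiM_scale:
  fixes f :: "('i \<Rightarrow> real) \<Rightarrow> ennreal"
  assumes "finite I" "f \<in> borel_measurable (PiM I (\<lambda>_. lborel))" "\<And>i. i \<in> I \<Longrightarrow> c i > 0"
  shows "(\<integral>\<^sup>+x. f x \<partial>PiM I (\<lambda>_. lborel)) =
         ennreal (\<Prod>i\<in>I. c i) * (\<integral>\<^sup>+x. f (\<lambda>i\<in>I. c i * x i) \<partial>PiM I (\<lambda>_. lborel))"
  using assms
proof (induction I arbitrary: f rule: finite_induct)
  case empty
  interpret product_sigma_finite "\<lambda>_ :: 'i. lborel :: real measure" ..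
  show ?case
    by (simp add: PiM_empty nn_integral_count_space_finite)
next
  case (insert i I)
  interpret product_sigma_finite "\<lambda>_ :: 'i. lborel :: real measure" ..
  define M where "M = PiM I (\<lambda>_. lborel :: real measure)"
  \<comment> \<open>\<open>g\<close> integrates out the new coordinate after it has been rescaled;
    the induction hypothesis is then applied to \<open>g\<close> itself.\<close>
  define g where "g = (\<lambda>x. \<integral>\<^sup>+y. f (x(i := c i * y)) \<partial>lborel)"
  have upd: "(\<lambda>(x, y). x(i := y)) \<in> M \<Otimes>\<^sub>M lborel \<rightarrow>\<^sub>M PiM (insert i I) (\<lambda>_. lborel)"
    unfolding M_def by (rule measurable_add_dim)
  have "(\<lambda>(x, y). (x, c i * y)) \<in> M \<Otimes>\<^sub>M lborel \<rightarrow>\<^sub>M M \<Otimes>\<^sub>M (lborel :: real measure)"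
    by measurable
  from measurable_compose[OF measurable_compose[OF this upd] insert.prems(1)]
  have "(\<lambda>(x, y). f (x(i := c i * y))) \<in> borel_measurable (M \<Otimes>\<^sub>M lborel)"
    by (simp only: case_prod_beta' fst_conv snd_conv)
  then have g: "g \<in> borel_measurable M"
    unfolding g_def by (rule lborel.borel_measurable_nn_integral)
  have inner: "(\<integral>\<^sup>+y. f (x(i := y)) \<partial>lborel) = c i * g x" if "x \<in> space M" for x
  proof -
    have "(\<lambda>y. f (x(i := y))) \<in> borel_measurable lborel"
      using measurable_compose[OF measurable_Pair1'[OF that, of lborel] measurable_compose[OF upd insert.prems(1)]]
      by (simp only: case_prod_conv)
    then have "(\<lambda>y. f (x(i := y))) \<in> borel_measurable borel"
      by simp
    from nn_integral_real_affine[OF this, of "c i" 0] show ?thesis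
      using insert.prems(2)[of i] by (simp add: g_def)
  qed
  have "(\<integral>\<^sup>+x. f x \<partial>PiM (insert i I) (\<lambda>_. lborel)) = (\<integral>\<^sup>+x. c i * g x \<partial>M)"
    using insert unfolding M_def[symmetric]
    by (subst product_nn_integral_insert) (auto simp: M_def[symmetric] inner intro!: nn_integral_cong)
  also have "\<dots> = c i * (\<integral>\<^sup>+x. g x \<partial>M)"
    by (rule nn_integral_cmult[OF g])
  also have "(\<integral>\<^sup>+x. g x \<partial>M) = ennreal (\<Prod>i\<in>I. c i) * (\<integral>\<^sup>+x. g (\<lambda>i\<in>I. c i * x i) \<partial>M)"
    unfolding M_def by (rule insert.IH) (use g insert.prems in \<open>auto simp: M_def\<close>)
  also have "(\<integral>\<^sup>+x. g (\<lambda>i\<in>I. c i * x i) \<partial>M) =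
      (\<integral>\<^sup>+x. \<integral>\<^sup>+y. f (\<lambda>j\<in>insert i I. c j * (x(i := y)) j) \<partial>lborel \<partial>M)"
  proof -
    have "(\<lambda>j\<in>I. c j * x j)(i := c i * y) = (\<lambda>j\<in>insert i I. c j * (x(i := y)) j)" for x y
      using insert.hyps by (auto simp: fun_eq_iff restrict_def)
    then show ?thesis by (simp add: g_def)
  qed
  also have "\<dots> = (\<integral>\<^sup>+x. f (\<lambda>j\<in>insert i I. c j * x j) \<partial>PiM (insert i I) (\<lambda>_. lborel))"
  proof (subst product_nn_integral_insert)
    have "(\<lambda>x. \<lambda>j\<in>insert i I. c j * x j) \<in> PiM (insert i I) (\<lambda>_. lborel) \<rightarrow>\<^sub>M PiM (insert i I) (\<lambda>_. lborel)"
      by measurable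
    from measurable_compose[OF this insert.prems(1)]
    show "(\<lambda>x. f (\<lambda>j\<in>insert i I. c j * x j)) \<in> borel_measurable (PiM (insert i I) (\<lambda>_. lborel))" .
  qed (use insert in \<open>auto simp: M_def\<close>)
  also have "c i * (ennreal (\<Prod>i\<in>I. c i) * \<dots>) = ennreal (\<Prod>i\<in>insert i I. c i) * \<dots>"
    using insert by (simp add: ennreal_mult prod_nonneg less_imp_le mult.assoc)
  finally show ?case .
qed

abbreviation lborel_on :: "nat set \<Rightarrow> (nat \<Rightarrow> real) measure" where
  "lborel_on I \<equiv> PiM I (\<lambda>_. lborel)"

abbreviation cube :: "nat set \<Rightarrow> (nat \<Rightarrow> real) set" where
  "cube I \<equiv> PiE I (\<lambda>_. {-1..1})"

abbreviation real_eval :: "complex polynomial \<Rightarrow> (nat \<Rightarrow> real) \<Rightarrow> complex" where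
  "real_eval F x \<equiv> eval_poly F (\<lambda>i. complex_of_real (x i))"

lemma emeasure_PiM_lborel_symmetric_box:
  assumes "finite I" "\<And>i. i \<in> I \<Longrightarrow> r i \<ge> 0"
  shows "emeasure (PiM I (\<lambda>_. lborel)) (PiE I (\<lambda>i. {- r i..r i})) = ennreal (\<Prod>i\<in>I. 2 * r i)"
proof -
  interpret product_sigma_finite "\<lambda>_ :: 'a. lborel :: real measure" ..
  have "emeasure (PiM I (\<lambda>_. lborel)) (PiE I (\<lambda>i. {- r i..r i})) = (\<Prod>i\<in>I. ennreal (2 * r i))"
    using assms by (subst emeasure_PiM) (auto intro!: prod.cong)
  then show ?thesis
    using assms by (simp add: prod_ennreal)
qed

lemma emeasure_cube:
  assumes "finite I"
  shows "emeasure (lborel_on I) (cube I) = ennreal (2 ^ card I)"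
  using emeasure_PiM_lborel_symmetric_box[OF assms, of "\<lambda>_. 1"] by simp

lemma cube_sets: "finite I \<Longrightarrow> cube I \<in> sets (lborel_on I)"
  by (auto intro!: sets_PiM_I_finite)

lemma sublevel_sets:
  assumes "in_variables N F"
  shows "{x \<in> space (lborel_on {..<N}). cmod (real_eval F x) \<le> \<delta>} \<in> sets (lborel_on {..<N})"
  using borel_measurable_eval_poly_of_real[OF assms] by measurable

section \<open>Linear volume bounds away from singular zeros\<close>

text \<open>\<open>F\<close> is complex valued, so the mean value inequality is applied to
  \<open>F - c * z\<close>, whose derivative is at most \<open>cmod c / 2\<close> in size. Thus the
  values of \<open>F\<close> at \<open>s\<close> and \<open>t\<close> differ by at least
  \<open>cmod c / 2 * \<bar>s - t\<bar>\<close>, while they differ by at most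
  \<open>2 * \<delta>\<close>.\<close>

lemma sublevel_section_width:
  assumes c: "c \<noteq> 0"
    and close: "\<And>z. z \<in> closed_segment s t \<Longrightarrow> cmod (real_eval (partial_deriv i F) (x(i := z)) - c) \<le> cmod c / 2"
    and s: "cmod (real_eval F (x(i := s))) \<le> \<delta>" and t: "cmod (real_eval F (x(i := t))) \<le> \<delta>"
  shows "\<bar>s - t\<bar> \<le> 4 * \<delta> / cmod c"
proof -
  define G where "G = (\<lambda>z. eval_poly F ((\<lambda>j. complex_of_real (x j))(i := z)))"
  have of_real_upd: "(\<lambda>j. complex_of_real ((x(i := z)) j)) = (\<lambda>j. complex_of_real (x j))(i := of_real z)" for z
    by auto
  have "norm ((G (of_real s) - c * of_real s) - (G (of_real t) - c * of_real t))
      \<le> cmod c / 2 * norm (complex_of_real s - of_real t)"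
  proof (rule field_differentiable_bound[where S = "closed_segment (of_real s) (of_real t)"
        and f = "\<lambda>z. G z - c * z"
        and f' = "\<lambda>z. eval_poly (partial_deriv i F) ((\<lambda>j. complex_of_real (x j))(i := z)) - c"])
    fix z assume z: "z \<in> closed_segment (complex_of_real s) (of_real t)"
    show "((\<lambda>z. G z - c * z) has_field_derivative
        eval_poly (partial_deriv i F) ((\<lambda>j. complex_of_real (x j))(i := z)) - c)
        (at z within closed_segment (of_real s) (of_real t))"
      unfolding G_def by (auto intro!: derivative_eq_intros has_field_derivative_eval_poly)
    from z obtain z' where "z' \<in> closed_segment s t" "z = of_real z'"
      by (auto simp: closed_segment_of_real)
    then show "norm (eval_poly (partial_deriv i F) ((\<lambda>j. complex_of_real (x j))(i := z)) - c) \<le> cmod c / 2"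
      using close[of z'] unfolding of_real_upd by simp
  qed auto
  moreover have "cmod (complex_of_real s - of_real t) = \<bar>s - t\<bar>"
    by (simp flip: of_real_diff)
  moreover have "cmod (c * (of_real s - of_real t)) \<le>
      norm ((G (of_real s) - c * of_real s) - (G (of_real t) - c * of_real t)) + cmod (G (of_real s)) + cmod (G (of_real t))"
  proof -
    have "c * (of_real s - of_real t) = G (of_real s) - G (of_real t) -
        ((G (of_real s) - c * of_real s) - (G (of_real t) - c * of_real t))"
      by (simp add: algebra_simps)
    then have "cmod (c * (of_real s - of_real t)) \<le> cmod (G (of_real s) - G (of_real t)) +
        norm ((G (of_real s) - c * of_real s) - (G (of_real t) - c * of_real t))"
      by (metis norm_triangle_ineq4)
    then show ?thesis
      using norm_triangle_ineq4[of "G (of_real s)" "G (of_real t)"] by linarith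
  qed
  moreover have "cmod (G (of_real s)) \<le> \<delta>" "cmod (G (of_real t)) \<le> \<delta>"
    using s t unfolding of_real_upd G_def by simp_all
  ultimately have "cmod c * \<bar>s - t\<bar> \<le> cmod c / 2 * \<bar>s - t\<bar> + \<delta> + \<delta>"
    by (simp add: norm_mult)
  then show ?thesis
    using c by (simp add: field_simps)
qed

text \<open>A bound on outer measure: asking for a measurable cover \<open>S\<close> avoids proving
  measurability of \<open>A\<close>, which will be given by open or compact sets of the product
  topology.\<close>

definition sublevel_volume_le :: "nat \<Rightarrow> complex polynomial \<Rightarrow> (nat \<Rightarrow> real) set \<Rightarrow> real \<Rightarrow> bool" where
  "sublevel_volume_le N F A C \<longleftrightarrow> C \<ge> 0 \<and>
     (\<forall>\<delta>\<ge>0. \<exists>S\<in>sets (lborel_on {..<N}). {x \<in> A. cmod (real_eval F x) \<le> \<delta>} \<subseteq> S \<and>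
        emeasure (lborel_on {..<N}) S \<le> ennreal (C * \<delta>))"

text \<open>If \<open>F\<close> does not vanish at \<open>y\<close>, small sublevel sets miss a
  neighbourhood of \<open>y\<close>. Otherwise some partial derivative is nearly constant and
  nonzero on a box around \<open>y\<close>, so all sections in that direction are short, and Tonelli
  gives the volume.\<close>

lemma local_volume_bound:
  assumes F: "in_variables N F" and y: "y \<in> cube {..<N}"
    and nonsing: "real_eval F y = 0 \<Longrightarrow> \<exists>i<N. real_eval (partial_deriv i F) y \<noteq> 0"
  shows "\<exists>U C. open U \<and> y \<in> U \<and> sublevel_volume_le N F (U \<inter> cube {..<N}) C"
proof (cases "real_eval F y = 0")
  case False
  define c where "c = cmod (real_eval F y)"
  have c: "c > 0" using False by (simp add: c_def)
  define U where "U = {x. c / 2 < cmod (real_eval F x)}"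
  have "open U" unfolding U_def
    by (intro open_Collect_less continuous_intros continuous_on_eval_poly_of_real)
  moreover have "y \<in> U" using c by (simp add: U_def c_def)
  moreover have "\<exists>S\<in>sets (lborel_on {..<N}).
       {x \<in> U \<inter> cube {..<N}. cmod (real_eval F x) \<le> \<delta>} \<subseteq> S \<and>
       emeasure (lborel_on {..<N}) S \<le> ennreal (2 ^ N * 2 / c * \<delta>)" if "\<delta> \<ge> 0" for \<delta>
  proof (cases "\<delta> \<le> c / 2")
    case True
    then show ?thesis by (intro bexI[of _ "{}"]) (auto simp: U_def)
  next
    case False
    \<comment> \<open>Now \<open>2 / c * \<delta>\<close> is at least 1, so the volume
      \<open>2 ^ N\<close> of the whole cube already meets the bound.\<close>
    then have "2 ^ N * 1 \<le> 2 ^ N * (2 / c * \<delta>)"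
      using c by (intro mult_left_mono) (auto simp: field_simps)
    then have "ennreal (2 ^ N) \<le> ennreal (2 ^ N * 2 / c * \<delta>)"
      by (intro ennreal_leI) (simp add: mult_ac)
    then show ?thesis
      by (intro bexI[of _ "cube {..<N}"]) (auto simp: emeasure_cube cube_sets)
  qed
  ultimately show ?thesis using c
    unfolding sublevel_volume_le_def by (intro exI[of _ U] exI[of _ "2 ^ N * 2 / c"]) auto
next
  case True
  then obtain i where i: "i < N" "real_eval (partial_deriv i F) y \<noteq> 0" using nonsing by blast
  define c where "c = real_eval (partial_deriv i F) y"
  have c: "c \<noteq> 0" using i by (simp add: c_def)
  define V where "V = {x. cmod (real_eval (partial_deriv i F) x - c) < cmod c / 2}"
  have "open V" unfolding V_def
    by (intro open_Collect_less continuous_intros continuous_on_eval_poly_of_real)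
  moreover have "y \<in> V" using c by (simp add: V_def c_def)
  ultimately obtain X where X: "y \<in> PiE UNIV X" "\<And>j. open (X j)" "finite {j. X j \<noteq> UNIV}" "PiE UNIV X \<subseteq> V"
    using product_topology_open_contains_basis[of "\<lambda>_. euclidean" UNIV V y]
    unfolding open_fun_def by auto
  \<comment> \<open>Side \<open>i\<close> of the basic box is shrunk to a ball, hence to a convex
    set: the segment between two points of a section must stay in the box for the mean value
    inequality.\<close>
  obtain r where r: "r > 0" "ball (y i) r \<subseteq> X i"
    using X(1,2) by (meson PiE_mem UNIV_I open_contains_ball)
  define Y where "Y = X(i := ball (y i) r)"
  have Y: "y \<in> PiE UNIV Y" "\<And>j. open (Y j)" "PiE UNIV Y \<subseteq> V"
  proof -
    show "y \<in> PiE UNIV Y" using X(1) r by (auto simp: Y_def PiE_iff)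
    show "open (Y j)" for j using X(2) by (simp add: Y_def)
    have "PiE UNIV Y \<subseteq> PiE UNIV X" using r by (intro PiE_mono) (auto simp: Y_def)
    then show "PiE UNIV Y \<subseteq> V" using X(4) by blast
  qed
  define I where "I = {..<N} - {i}"
  have I: "{..<N} = insert i I" "finite I" "i \<notin> I" using i by (auto simp: I_def)
  define C where "C = 2 ^ card I * 8 / cmod c"
  interpret product_sigma_finite "\<lambda>_ :: nat. lborel :: real measure" ..
  have "{j. Y j \<noteq> UNIV} \<subseteq> insert i {j. X j \<noteq> UNIV}"
    by (auto simp: Y_def)
  then have "open (PiE UNIV Y)"
    using X(3) Y(2) by (intro open_PiE) (auto intro: finite_subset)
  moreover have "\<exists>S\<in>sets (lborel_on {..<N}).
       {x \<in> PiE UNIV Y \<inter> cube {..<N}. cmod (real_eval F x) \<le> \<delta>} \<subseteq> S \<and>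
       emeasure (lborel_on {..<N}) S \<le> ennreal (C * \<delta>)" if \<delta>: "\<delta> \<ge> 0" for \<delta>
  proof (intro bexI conjI)
    let ?S = "PiE {..<N} (\<lambda>j. Y j \<inter> {-1..1}) \<inter> {x \<in> space (lborel_on {..<N}). cmod (real_eval F x) \<le> \<delta>}"
    show S: "?S \<in> sets (lborel_on {..<N})"
      using Y by (intro sets.Int sublevel_sets F sets_PiM_I_finite) auto
    show "{x \<in> PiE UNIV Y \<inter> cube {..<N}. cmod (real_eval F x) \<le> \<delta>} \<subseteq> ?S"
      by (auto simp: space_PiM PiE_iff extensional_def)
    have section_le: "(\<integral>\<^sup>+t. indicator ?S (x(i := t)) \<partial>lborel) \<le> ennreal (8 * \<delta> / cmod c) * indicator (cube I) x"
      if x: "x \<in> space (lborel_on I)" for x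
    proof (cases "\<exists>s. x(i := s) \<in> ?S")
      case False
      then show ?thesis by simp
    next
      case True
      then obtain s where s: "x(i := s) \<in> ?S" by blast
      have xI: "x \<in> cube I"
        unfolding PiE_iff
      proof (intro conjI ballI)
        show "x j \<in> {-1..1}" if "j \<in> I" for j
          using PiE_mem[of "x(i := s)" "{..<N}" "\<lambda>j. Y j \<inter> {-1..1}" j] s that by (auto simp: I_def)
        show "x \<in> extensional I" using x by (auto simp: space_PiM PiE_iff)
      qed
      have "\<bar>s - t\<bar> \<le> 4 * \<delta> / cmod c" if t: "x(i := t) \<in> ?S" for t
      proof (rule sublevel_section_width[OF c])
        fix z assume z: "z \<in> closed_segment s t"
        have "s \<in> Y i" "t \<in> Y i"
          using PiE_mem[of "x(i := s)" "{..<N}" "\<lambda>j. Y j \<inter> {-1..1}" i]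
            PiE_mem[of "x(i := t)" "{..<N}" "\<lambda>j. Y j \<inter> {-1..1}" i] s t i by auto
        moreover have "convex (Y i)" by (simp add: Y_def)
        ultimately have zY: "z \<in> Y i"
          using z closed_segment_subset by blast
        have "(x(i := z)) j \<in> Y j" for j
        proof -
          consider "j = i" | "j \<in> I" | "j \<notin> {..<N}" using I by blast
          then show ?thesis
          proof cases
            case 2
            then show ?thesis
              using PiE_mem[of "x(i := s)" "{..<N}" "\<lambda>j. Y j \<inter> {-1..1}" j] s by (auto simp: I_def)
          next
            case 3
            \<comment> \<open>Outside the index set all points of the product space take the value
              \<open>undefined\<close>, so \<open>x\<close> agrees there with \<open>y\<close>,
              which lies in the box.\<close>
            then have "x j = undefined" "y j = undefined" "j \<noteq> i"
              using x y i by (auto simp: space_PiM PiE_iff extensional_def I_def)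
            then show ?thesis using Y(1) by (auto simp: PiE_iff) metis
          qed (use zY in simp)
        qed
        then have "x(i := z) \<in> V" using Y(3) by (auto simp: PiE_iff)
        then show "cmod (real_eval (partial_deriv i F) (x(i := z)) - c) \<le> cmod c / 2"
          by (simp add: V_def)
      qed (use s t in auto)
      \<comment> \<open>The section lies in an interval centred at one of its own points
        \<open>s\<close>, with the diameter bound as radius; this turns the 4 into an 8.\<close>
      then have "indicator ?S (x(i := t)) \<le> (indicator {s - 4 * \<delta> / cmod c..s + 4 * \<delta> / cmod c} t :: ennreal)" for t
        by (auto simp: indicator_def abs_le_iff algebra_simps simp del: Int_iff)
      then have "(\<integral>\<^sup>+t. indicator ?S (x(i := t)) \<partial>lborel)
          \<le> (\<integral>\<^sup>+t. indicator {s - 4 * \<delta> / cmod c..s + 4 * \<delta> / cmod c} t \<partial>lborel)"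
        by (intro nn_integral_mono)
      also have "\<dots> = ennreal (8 * \<delta> / cmod c)"
        using \<delta> by (simp add: field_simps)
      finally show ?thesis using xI by simp
    qed
    have "emeasure (lborel_on {..<N}) ?S = (\<integral>\<^sup>+x. indicator ?S x \<partial>lborel_on {..<N})"
      using S by simp
    also have "\<dots> = (\<integral>\<^sup>+x. \<integral>\<^sup>+t. indicator ?S (x(i := t)) \<partial>lborel \<partial>lborel_on I)"
    proof -
      have "(indicator ?S :: _ \<Rightarrow> ennreal) \<in> borel_measurable (lborel_on (insert i I))"
        using S unfolding I(1) by (rule borel_measurable_indicator)
      from product_nn_integral_insert[OF I(2,3) this] show ?thesis
        unfolding I(1) .
    qed
    also have "\<dots> \<le> (\<integral>\<^sup>+x. ennreal (8 * \<delta> / cmod c) * indicator (cube I) x \<partial>lborel_on I)"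
      by (rule nn_integral_mono) (rule section_le)
    also have "\<dots> = ennreal (8 * \<delta> / cmod c) * ennreal (2 ^ card I)"
      using I(2) by (simp add: nn_integral_cmult_indicator cube_sets emeasure_cube)
    also have "\<dots> = ennreal (C * \<delta>)"
      using \<delta> by (simp add: C_def mult_ac flip: ennreal_mult)
    finally show "emeasure (lborel_on {..<N}) ?S \<le> ennreal (C * \<delta>)" .
  qed
  moreover have "C \<ge> 0" by (simp add: C_def)
  ultimately show ?thesis using Y(1)
    unfolding sublevel_volume_le_def by (intro exI[of _ "PiE UNIV Y"] exI[of _ C]) auto
qed

text \<open>Finitely many of the local neighbourhoods cover \<open>K\<close>, and their constants
  add up.\<close>

lemma compact_volume_bound:
  assumes F: "in_variables N F" and K: "compact K" "K \<subseteq> cube {..<N}"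
    and nonsing: "\<And>y. y \<in> K \<Longrightarrow> real_eval F y = 0 \<Longrightarrow> \<exists>i<N. real_eval (partial_deriv i F) y \<noteq> 0"
  shows "\<exists>C. sublevel_volume_le N F K C"
proof -
  have "\<exists>U C. open U \<and> y \<in> U \<and> sublevel_volume_le N F (U \<inter> cube {..<N}) C" if "y \<in> K" for y
    using local_volume_bound[OF F subsetD[OF K(2) that] nonsing[OF that]] .
  then obtain U C where UC: "\<And>y. y \<in> K \<Longrightarrow> open (U y)" "\<And>y. y \<in> K \<Longrightarrow> y \<in> U y"
      "\<And>y. y \<in> K \<Longrightarrow> sublevel_volume_le N F (U y \<inter> cube {..<N}) (C y)"
    by metis
  obtain D where D: "D \<subseteq> K" "finite D" "K \<subseteq> (\<Union>y\<in>D. U y)"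
    using compactE_image[OF K(1), of K U] UC(1,2) by blast
  have C: "C y \<ge> 0" if "y \<in> D" for y
    using UC(3) D(1) that by (auto simp: sublevel_volume_le_def)
  have "\<exists>S\<in>sets (lborel_on {..<N}). {x \<in> K. cmod (real_eval F x) \<le> \<delta>} \<subseteq> S \<and>
       emeasure (lborel_on {..<N}) S \<le> ennreal ((\<Sum>y\<in>D. C y) * \<delta>)" if \<delta>: "\<delta> \<ge> 0" for \<delta>
  proof -
    have "\<forall>y\<in>D. \<exists>S. S \<in> sets (lborel_on {..<N}) \<and>
       {x \<in> U y \<inter> cube {..<N}. cmod (real_eval F x) \<le> \<delta>} \<subseteq> S \<and>
       emeasure (lborel_on {..<N}) S \<le> ennreal (C y * \<delta>)"
    proof
      fix y assume "y \<in> D"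
      then have "sublevel_volume_le N F (U y \<inter> cube {..<N}) (C y)" using UC(3) D(1) by auto
      then show "\<exists>S. S \<in> sets (lborel_on {..<N}) \<and>
         {x \<in> U y \<inter> cube {..<N}. cmod (real_eval F x) \<le> \<delta>} \<subseteq> S \<and>
         emeasure (lborel_on {..<N}) S \<le> ennreal (C y * \<delta>)"
        using \<delta> unfolding sublevel_volume_le_def Bex_def by simp
    qed
    from bchoice[OF this] obtain S where S: "\<forall>y\<in>D. S y \<in> sets (lborel_on {..<N}) \<and>
       {x \<in> U y \<inter> cube {..<N}. cmod (real_eval F x) \<le> \<delta>} \<subseteq> S y \<and>
       emeasure (lborel_on {..<N}) (S y) \<le> ennreal (C y * \<delta>)" ..
    show ?thesis
    proof (intro bexI conjI)
      show "(\<Union>y\<in>D. S y) \<in> sets (lborel_on {..<N})"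
        using S D by (intro sets.finite_UN) auto
      have "emeasure (lborel_on {..<N}) (\<Union>y\<in>D. S y) \<le> (\<Sum>y\<in>D. emeasure (lborel_on {..<N}) (S y))"
        using S D by (intro emeasure_subadditive_finite) auto
      also have "\<dots> \<le> (\<Sum>y\<in>D. ennreal (C y * \<delta>))"
        using S by (intro sum_mono) auto
      also have "\<dots> = ennreal (\<Sum>y\<in>D. C y * \<delta>)"
        using C \<delta> by (intro sum_ennreal) auto
      finally show "emeasure (lborel_on {..<N}) (\<Union>y\<in>D. S y) \<le> ennreal ((\<Sum>y\<in>D. C y) * \<delta>)"
        by (simp add: sum_distrib_right)
      show "{x \<in> K. cmod (real_eval F x) \<le> \<delta>} \<subseteq> (\<Union>y\<in>D. S y)"
      proof
        fix x assume x: "x \<in> {x \<in> K. cmod (real_eval F x) \<le> \<delta>}"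
        then obtain y where y: "y \<in> D" "x \<in> U y" using D by auto
        then have "x \<in> {x \<in> U y \<inter> cube {..<N}. cmod (real_eval F x) \<le> \<delta>}" using x K(2) by auto
        with S y(1) show "x \<in> (\<Union>y\<in>D. S y)" by blast
      qed
    qed
  qed
  then show ?thesis
    using C unfolding sublevel_volume_le_def by (intro exI[of _ "\<Sum>y\<in>D. C y"]) (auto intro: sum_nonneg)
qed

text \<open>Extensional functions have the one-point factor \<open>{undefined}\<close> at every
  index outside \<open>{..<N}\<close>, so the cube is a product of compact sets over all indices and
  Tychonoff applies.\<close>

lemma compact_cube: "compact (cube {..<N})"
proof -
  let ?A = "\<lambda>i. if i < N then {-1..1::real} else {undefined}"
  have "x \<in> cube {..<N} \<longleftrightarrow> x \<in> PiE UNIV ?A" for x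
  proof
    assume "x \<in> cube {..<N}"
    then show "x \<in> PiE UNIV ?A"
      by (intro PiE_I) (simp_all add: PiE_iff extensional_def)
  next
    assume x: "x \<in> PiE UNIV ?A"
    show "x \<in> cube {..<N}"
    proof (rule PiE_I)
      show "x i \<in> {-1..1}" if "i \<in> {..<N}" for i
        using PiE_mem[OF x, of i] that by simp
      show "x i = undefined" if "i \<notin> {..<N}" for i
        using PiE_mem[OF x, of i] that by simp
    qed
  qed
  then have "cube {..<N} = PiE UNIV ?A" by blast
  moreover have "compactin (product_topology (\<lambda>_. euclidean) UNIV) (PiE UNIV ?A)"
    unfolding compactin_PiE by (intro disjI2 ballI) simp
  ultimately show ?thesis
    by (simp only: euclidean_product_topology compactin_euclidean_iff)
qed

section \<open>Upper bound by weighted dilation\<close>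

definition sublevel_volume :: "nat \<Rightarrow> complex polynomial \<Rightarrow> real \<Rightarrow> real" where
  "sublevel_volume N F \<delta> = measure (lborel_on {..<N}) {x \<in> cube {..<N}. cmod (real_eval F x) \<le> \<delta>}"

lemma sublevel_cube_sets:
  assumes "in_variables N F"
  shows "{x \<in> cube {..<N}. cmod (real_eval F x) \<le> \<delta>} \<in> sets (lborel_on {..<N})"
proof -
  have "{x \<in> cube {..<N}. cmod (real_eval F x) \<le> \<delta>} =
      cube {..<N} \<inter> {x \<in> space (lborel_on {..<N}). cmod (real_eval F x) \<le> \<delta>}"
    using sets.sets_into_space[OF cube_sets[of "{..<N}"]] by blast
  also have "\<dots> \<in> sets (lborel_on {..<N})"
    by (intro sets.Int cube_sets sublevel_sets assms finite_lessThan)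
  finally show ?thesis .
qed

lemma emeasure_sublevel:
  assumes "in_variables N F"
  shows "emeasure (lborel_on {..<N}) {x \<in> cube {..<N}. cmod (real_eval F x) \<le> \<delta>} =
     ennreal (sublevel_volume N F \<delta>)"
proof -
  have "emeasure (lborel_on {..<N}) {x \<in> cube {..<N}. cmod (real_eval F x) \<le> \<delta>} \<le>
      emeasure (lborel_on {..<N}) (cube {..<N})"
    by (rule emeasure_mono) (auto simp: cube_sets)
  also have "\<dots> < \<infinity>" by (simp add: emeasure_cube)
  finally show ?thesis
    unfolding sublevel_volume_def by (intro emeasure_eq_ennreal_measure) auto
qed

text \<open>The cube is the outer annulus \<open>K\<close> together with a dilate of the cube,
  coordinate \<open>i\<close> being scaled by \<open>(1/2) ^ (a ! i)\<close>. The annulus avoids the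
  origin, so \<open>F\<close> has no singular zero on it and it contributes
  \<open>C * \<delta>\<close>; the dilate contributes the Jacobian times the volume at the rescaled
  level.\<close>

lemma sublevel_volume_recursion:
  assumes F: "weighted_homogeneous a d F" and smooth: "smooth_away_from_origin (length a) F"
  shows "\<exists>C\<ge>0. \<forall>\<delta>\<ge>0. sublevel_volume (length a) F \<delta> \<le>
    C * \<delta> + (1/2) ^ (\<Sum>i<length a. a ! i) * sublevel_volume (length a) F (2 ^ d * \<delta>)"
proof -
  define N where "N = length a"
  define c where "c = (\<lambda>i. (1/2::real) ^ (a ! i))"
  define K where "K = cube {..<N} \<inter> (\<Union>i<N. {x. c i \<le> \<bar>x i\<bar>})"
  let ?M = "lborel_on {..<N}"
  let ?V = "\<lambda>\<delta>. {x \<in> cube {..<N}. cmod (real_eval F x) \<le> \<delta>}"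
  have inv: "in_variables N F" using F by (simp add: weighted_homogeneous_def N_def)
  have "closed (\<Union>i<N. {x :: nat \<Rightarrow> real. c i \<le> \<bar>x i\<bar>})"
    by (intro closed_UN ballI finite_lessThan closed_Collect_le continuous_intros continuous_on_product_coordinates)
  then have "compact K" unfolding K_def by (intro compact_Int_closed compact_cube)
  moreover have "\<exists>i<N. real_eval (partial_deriv i F) y \<noteq> 0" if y: "y \<in> K" "real_eval F y = 0" for y
  proof -
    obtain i where i: "i < N" "c i \<le> \<bar>y i\<bar>" using y(1) by (auto simp: K_def)
    moreover have "c i > 0" by (simp add: c_def)
    ultimately have "complex_of_real (y i) \<noteq> 0" by auto
    with i(1) y(2) smooth show ?thesis
      unfolding smooth_away_from_origin_def N_def
      by (elim allE[of _ "\<lambda>i. complex_of_real (y i)"]) blast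
  qed
  ultimately obtain C where C: "sublevel_volume_le N F K C"
    using compact_volume_bound[OF inv, of K] by (auto simp: K_def)
  have rec: "sublevel_volume N F \<delta> \<le>
    C * \<delta> + (1/2) ^ (\<Sum>i<N. a ! i) * sublevel_volume N F (2 ^ d * \<delta>)" if \<delta>: "\<delta> \<ge> 0" for \<delta>
  proof -
    obtain S where S: "S \<in> sets ?M" "{x \<in> K. cmod (real_eval F x) \<le> \<delta>} \<subseteq> S"
      "emeasure ?M S \<le> ennreal (C * \<delta>)"
      using C \<delta> unfolding sublevel_volume_le_def by blast
    \<comment> \<open>\<open>W\<close> is the part of the sublevel set in the dilated cube; pulling
      it back to the cube multiplies the level by \<open>2 ^ d\<close>.\<close>
    define W where "W = PiE {..<N} (\<lambda>i. {- c i..c i}) \<inter> {x \<in> space ?M. cmod (real_eval F x) \<le> \<delta>}"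
    have W: "W \<in> sets ?M"
      unfolding W_def by (intro sets.Int sublevel_sets inv sets_PiM_I_finite) auto
    have dilate: "(\<lambda>i\<in>{..<N}. c i * x i) \<in> W \<longleftrightarrow> x \<in> ?V (2 ^ d * \<delta>)" if x: "x \<in> space ?M" for x
    proof -
      have "real_eval F (\<lambda>i\<in>{..<N}. c i * x i) =
          eval_poly F (\<lambda>i. (1/2) ^ (a ! i) * complex_of_real (x i))"
        by (rule eval_poly_cong[OF inv]) (simp add: c_def)
      also have "\<dots> = (1/2) ^ d * real_eval F x"
        by (rule eval_poly_weighted_scale[OF F])
      finally have "cmod (real_eval F (\<lambda>i\<in>{..<N}. c i * x i)) = (1/2) ^ d * cmod (real_eval F x)"
        by (simp add: norm_mult norm_power norm_divide)
      moreover have "(1/2) ^ d * cmod (real_eval F x) \<le> \<delta> \<longleftrightarrow> cmod (real_eval F x) \<le> 2 ^ d * \<delta>"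
        by (simp add: field_simps)
      moreover have "- c i \<le> c i * t \<and> c i * t \<le> c i \<longleftrightarrow> -1 \<le> t \<and> t \<le> 1" for i t
        using mult_le_cancel_left_pos[of "c i" "-1" t] mult_le_cancel_left_pos[of "c i" t 1]
        by (simp add: c_def)
      ultimately show ?thesis
        using x by (auto simp: W_def space_PiM PiE_iff)
    qed
    have "emeasure ?M W = (\<integral>\<^sup>+x. indicator W x \<partial>?M)" using W by simp
    also have "\<dots> = ennreal (\<Prod>i<N. c i) * (\<integral>\<^sup>+x. indicator W (\<lambda>i\<in>{..<N}. c i * x i) \<partial>?M)"
      by (rule nn_integral_PiM_scale) (use W in \<open>auto simp: c_def\<close>)
    also have "(\<integral>\<^sup>+x. indicator W (\<lambda>i\<in>{..<N}. c i * x i) \<partial>?M) = (\<integral>\<^sup>+x. indicator (?V (2 ^ d * \<delta>)) x \<partial>?M)"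
      by (rule nn_integral_cong) (simp only: dilate indicator_def)
    also have "\<dots> = ennreal (sublevel_volume N F (2 ^ d * \<delta>))"
      using sublevel_cube_sets[OF inv] by (simp add: emeasure_sublevel[OF inv])
    also have "(\<Prod>i<N. c i) = (1/2) ^ (\<Sum>i<N. a ! i)"
      by (simp add: c_def power_sum)
    finally have emW: "emeasure ?M W = ennreal ((1/2) ^ (\<Sum>i<N. a ! i) * sublevel_volume N F (2 ^ d * \<delta>))"
      by (simp add: ennreal_mult sublevel_volume_def)
    have "?V \<delta> \<subseteq> S \<union> W"
    proof
      fix x assume x: "x \<in> ?V \<delta>"
      show "x \<in> S \<union> W"
      proof (cases "x \<in> K")
        case True
        then show ?thesis using S(2) x by blast
      next
        case False
        then have "\<bar>x i\<bar> < c i" if "i < N" for i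
          using x that by (auto simp: K_def not_le)
        then have "x i \<in> {- c i..c i}" if "i < N" for i
          using that by (force simp: abs_less_iff)
        then have "x \<in> PiE {..<N} (\<lambda>i. {- c i..c i})"
          using x by (simp add: PiE_iff)
        then show ?thesis using x by (auto simp: W_def space_PiM PiE_iff)
      qed
    qed
    then have "emeasure ?M (?V \<delta>) \<le> emeasure ?M (S \<union> W)"
      using S W by (intro emeasure_mono) auto
    also have "\<dots> \<le> emeasure ?M S + emeasure ?M W"
      using S W by (intro emeasure_subadditive)
    also have "\<dots> \<le> ennreal (C * \<delta>) + ennreal ((1/2) ^ (\<Sum>i<N. a ! i) * sublevel_volume N F (2 ^ d * \<delta>))"
      using S emW by (intro add_mono) auto
    also have "\<dots> = ennreal (C * \<delta> + (1/2) ^ (\<Sum>i<N. a ! i) * sublevel_volume N F (2 ^ d * \<delta>))"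
      using C \<delta> by (intro ennreal_plus[symmetric]) (auto simp: sublevel_volume_le_def sublevel_volume_def)
    finally have "ennreal (sublevel_volume N F \<delta>) \<le>
        ennreal (C * \<delta> + (1/2) ^ (\<Sum>i<N. a ! i) * sublevel_volume N F (2 ^ d * \<delta>))"
      by (simp only: emeasure_sublevel[OF inv])
    then show ?thesis
      using C \<delta> by (subst (asm) ennreal_le_iff) (auto simp: sublevel_volume_le_def sublevel_volume_def)
  qed
  then show ?thesis
    using C unfolding sublevel_volume_le_def N_def by blast
qed

text \<open>Iterating the recursion along levels \<open>c * (1/2) ^ (d * k)\<close>, the normalised
  volume \<open>2 ^ (A * k) * v k\<close> grows in the step to \<open>Suc k\<close> by at most
  \<open>C * c * (1/2) ^ ((d - A) * Suc k)\<close>. As \<open>A < d\<close>, these increments are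
  dominated by a convergent geometric series.\<close>

lemma sublevel_volume_decay:
  assumes F: "weighted_homogeneous a d F" and smooth: "smooth_away_from_origin (length a) F"
    and small: "(\<Sum>i<length a. a ! i) < d" and c: "c \<ge> 0"
  shows "\<exists>B\<ge>0. \<forall>k. sublevel_volume (length a) F (c * (1/2) ^ (d * k)) \<le> B * (1/2) ^ ((\<Sum>i<length a. a ! i) * k)"
proof -
  define A where "A = (\<Sum>i<length a. a ! i)"
  define v where "v = (\<lambda>k. sublevel_volume (length a) F (c * (1/2) ^ (d * k)))"
  obtain C where C: "C \<ge> 0" "\<forall>\<delta>\<ge>0. sublevel_volume (length a) F \<delta> \<le>
    C * \<delta> + (1/2) ^ A * sublevel_volume (length a) F (2 ^ d * \<delta>)"
    using sublevel_volume_recursion[OF F smooth, folded A_def] by (elim exE conjE)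
  have half: "2 ^ n * (1/2::real) ^ n = 1" for n :: nat
    by (simp flip: power_mult_distrib)
  have step: "v (Suc k) \<le> C * c * (1/2) ^ (d * Suc k) + (1/2) ^ A * v k" for k
  proof -
    have "2 ^ d * (c * (1/2) ^ (d * Suc k)) = c * (1/2) ^ (d * k)"
      using half[of d] by (simp only: mult_Suc_right power_add mult_ac) (simp flip: mult.assoc)
    then show ?thesis
      using C(2)[THEN spec, of "c * (1/2) ^ (d * Suc k)"] c unfolding v_def by (simp only: mult.assoc) simp
  qed
  \<comment> \<open>\<open>1 - (1/2) ^ k\<close> is the sum of the first \<open>k\<close> terms of
    1/2 + 1/4 + ..., the dominating series.\<close>
  have "2 ^ (A * k) * v k \<le> v 0 + C * c * (1 - (1/2) ^ k)" for k
  proof (induction k)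
    case (Suc k)
    have "2 ^ (A * Suc k) * v (Suc k) \<le> 2 ^ (A * Suc k) * (C * c * (1/2) ^ (d * Suc k) + (1/2) ^ A * v k)"
      by (intro mult_left_mono step) auto
    also have "\<dots> = C * c * (2 ^ (A * Suc k) * (1/2) ^ (d * Suc k)) + 2 ^ (A * k) * (2 ^ A * (1/2) ^ A) * v k"
      by (simp only: distrib_left mult_Suc_right power_add mult_ac)
    also have "2 ^ A * (1/2::real) ^ A = 1" by (rule half)
    also have "2 ^ (A * Suc k) * (1/2::real) ^ (d * Suc k) = (1/2) ^ ((d - A) * Suc k)"
    proof -
      have "d * Suc k = A * Suc k + (d - A) * Suc k"
        using small by (simp add: A_def flip: distrib_right)
      then have "(1/2::real) ^ (d * Suc k) = (1/2) ^ (A * Suc k) * (1/2) ^ ((d - A) * Suc k)"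
        by (simp only: power_add)
      then show ?thesis using half[of "A * Suc k"] by (simp only: mult.assoc[symmetric] mult_1)
    qed
    also have "\<dots> \<le> (1/2) ^ Suc k"
    proof (rule power_decreasing)
      have "1 * Suc k \<le> (d - A) * Suc k"
        using small by (intro mult_right_mono) (auto simp: A_def)
      then show "Suc k \<le> (d - A) * Suc k" by (simp only: mult_1)
    qed auto
    finally have "2 ^ (A * Suc k) * v (Suc k) \<le> C * c * (1/2) ^ Suc k + 2 ^ (A * k) * v k"
      using C(1) c by (simp add: mult_left_mono)
    with Suc.IH show ?case by (simp add: algebra_simps)
  qed simp
  moreover have "C * c * (1 - (1/2) ^ k) \<le> C * c" for k
    using C(1) c by (intro mult_right_le_one_le) (auto intro: power_le_one)
  ultimately have "2 ^ (A * k) * v k \<le> v 0 + C * c" for k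
    by (meson add_left_mono order_trans)
  then have "(1/2) ^ (A * k) * (2 ^ (A * k) * v k) \<le> (1/2) ^ (A * k) * (v 0 + C * c)" for k
    by (intro mult_left_mono) auto
  moreover have "(1/2) ^ (A * k) * (2 ^ (A * k) * v k) = v k" for k
    using half[of "A * k"] by (simp only: mult.assoc[symmetric] mult.commute[of "(1/2) ^ (A * k)"] mult_1)
  ultimately have "v k \<le> (v 0 + C * c) * (1/2) ^ (A * k)" for k
    by (metis mult.commute)
  moreover have "v 0 + C * c \<ge> 0"
    using C(1) c by (simp add: v_def sublevel_volume_def)
  ultimately show ?thesis
    unfolding v_def A_def by blast
qed

section \<open>Lower bound by boxes and optimality of the weights\<close>

text \<open>On the box with half-sides \<open>q powr w i\<close> every monomial of \<open>F\<close>
  is at most \<open>q ^ d\<close> in size, so the box lies in the sublevel set.\<close>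

lemma sublevel_volume_ge:
  fixes w :: "nat \<Rightarrow> real"
  assumes F: "in_variables N F"
    and w: "\<And>i. i < N \<Longrightarrow> w i \<ge> 0" "\<And>m. m \<in> Poly_Mapping.keys F \<Longrightarrow> (\<Sum>i<N. w i * Poly_Mapping.lookup m i) \<ge> d"
    and q: "0 < q" "q \<le> 1"
  shows "2 ^ N * q powr (\<Sum>i<N. w i) \<le>
    sublevel_volume N F ((\<Sum>m\<in>Poly_Mapping.keys F. cmod (Poly_Mapping.lookup F m)) * q ^ d)"
    (is "_ \<le> sublevel_volume N F (?c * q ^ d)")
proof -
  let ?Box = "PiE {..<N} (\<lambda>i. {- (q powr w i)..q powr w i})"
  have "cmod (real_eval F x) \<le> ?c * q ^ d" if x: "x \<in> ?Box" for x
  proof -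
    have mono: "cmod (\<Prod>i\<in>Poly_Mapping.keys m. complex_of_real (x i) ^ Poly_Mapping.lookup m i) \<le> q ^ d"
      if m: "m \<in> Poly_Mapping.keys F" for m
    proof -
      have keys: "Poly_Mapping.keys m \<subseteq> {..<N}" using F m by (auto simp: in_variables_def)
      have "cmod (\<Prod>i\<in>Poly_Mapping.keys m. complex_of_real (x i) ^ Poly_Mapping.lookup m i) =
          (\<Prod>i\<in>Poly_Mapping.keys m. \<bar>x i\<bar> ^ Poly_Mapping.lookup m i)"
        by (simp add: norm_power flip: prod_norm)
      also have "\<dots> \<le> (\<Prod>i\<in>Poly_Mapping.keys m. (q powr w i) ^ Poly_Mapping.lookup m i)"
        using x keys by (intro prod_mono conjI power_mono) (auto simp: PiE_iff abs_le_iff minus_le_iff subset_iff)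
      also have "\<dots> = q powr (\<Sum>i\<in>Poly_Mapping.keys m. w i * Poly_Mapping.lookup m i)"
        using q by (simp add: powr_sum powr_power mult.commute)
      also have "(\<Sum>i\<in>Poly_Mapping.keys m. w i * Poly_Mapping.lookup m i) = (\<Sum>i<N. w i * Poly_Mapping.lookup m i)"
        using keys by (intro sum.mono_neutral_left) (auto simp: in_keys_iff)
      also have "q powr \<dots> \<le> q powr d"
        using w(2)[OF m] q by (intro powr_mono') auto
      also have "\<dots> = q ^ d" using q by (simp add: powr_realpow)
      finally show ?thesis .
    qed
    have "cmod (real_eval F x) \<le> (\<Sum>m\<in>Poly_Mapping.keys F. cmod (Poly_Mapping.lookup F m) * q ^ d)"
      unfolding eval_poly_def
      by (rule sum_norm_le) (use mono in \<open>auto simp: norm_mult intro!: mult_left_mono\<close>)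
    then show ?thesis by (simp add: sum_distrib_right)
  qed
  moreover have "?Box \<subseteq> cube {..<N}"
  proof (rule PiE_mono)
    fix i assume "i \<in> {..<N}"
    then have "q powr w i \<le> 1" using w(1) q by (intro powr_le1) auto
    then show "{- (q powr w i)..q powr w i} \<subseteq> {-1..1}" by auto
  qed
  ultimately have "?Box \<subseteq> {x \<in> cube {..<N}. cmod (real_eval F x) \<le> ?c * q ^ d}" by blast
  then have "emeasure (lborel_on {..<N}) ?Box \<le> ennreal (sublevel_volume N F (?c * q ^ d))"
    unfolding emeasure_sublevel[OF F, symmetric]
    by (intro emeasure_mono sublevel_cube_sets F)
  also have "emeasure (lborel_on {..<N}) ?Box = ennreal (\<Prod>i<N. 2 * q powr w i)"
    by (rule emeasure_PiM_lborel_symmetric_box) auto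
  also have "(\<Prod>i<N. 2 * q powr w i) = 2 ^ N * q powr (\<Sum>i<N. w i)"
    using q by (simp add: prod.distrib powr_sum)
  finally show ?thesis
    by (simp add: sublevel_volume_def)
qed

text \<open>Both volume bounds are compared at \<open>q = (1/2) ^ k\<close>: dividing by
  \<open>q powr W\<close> leaves \<open>2 ^ N\<close> below \<open>B * q powr (A - W)\<close>, which
  fails for large \<open>k\<close> if \<open>W < A\<close>.\<close>

lemma weight_sum_minimal:
  fixes w :: "nat \<Rightarrow> real"
  assumes F: "weighted_homogeneous a d F" and smooth: "smooth_away_from_origin (length a) F"
    and small: "(\<Sum>i<length a. a ! i) < d"
    and w: "\<And>i. i < length a \<Longrightarrow> w i \<ge> 0"
      "\<And>m. m \<in> Poly_Mapping.keys F \<Longrightarrow> (\<Sum>i<length a. w i * Poly_Mapping.lookup m i) \<ge> d"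
  shows "real (\<Sum>i<length a. a ! i) \<le> (\<Sum>i<length a. w i)"
proof (rule ccontr)
  define N where "N = length a"
  define A where "A = (\<Sum>i<N. a ! i)"
  define W where "W = (\<Sum>i<N. w i)"
  define c where "c = (\<Sum>m\<in>Poly_Mapping.keys F. cmod (Poly_Mapping.lookup F m))"
  define e where "e = real A - W"
  assume "\<not> ?thesis"
  then have e: "e > 0" by (simp add: e_def A_def W_def N_def)
  have inv: "in_variables N F" using F by (simp add: weighted_homogeneous_def N_def)
  have "c \<ge> 0" unfolding c_def by (simp add: sum_nonneg)
  from sublevel_volume_decay[OF F smooth small this, folded N_def, folded A_def] obtain B where
    B: "B \<ge> 0" "\<forall>k. sublevel_volume N F (c * (1/2) ^ (d * k)) \<le> B * (1/2) ^ (A * k)"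
    by (elim exE conjE)
  have "2 ^ N \<le> B * ((1/2) powr e) ^ k" for k
  proof -
    define q where "q = (1/2::real) ^ k"
    have q: "0 < q" "q \<le> 1" by (auto simp: q_def power_le_one)
    have "2 ^ N * q powr W \<le> sublevel_volume N F (c * q ^ d)"
      unfolding W_def c_def by (rule sublevel_volume_ge[OF inv]) (use w q in \<open>auto simp: N_def\<close>)
    also have "q ^ d = (1/2) ^ (d * k)" by (simp add: q_def mult.commute flip: power_mult)
    also have "sublevel_volume N F (c * \<dots>) \<le> B * (1/2) ^ (A * k)" using B(2) ..
    also have "(1/2) ^ (A * k) = q ^ A" by (simp add: q_def mult.commute flip: power_mult)
    also have "q ^ A = q powr e * q powr W"
      using q by (simp add: e_def powr_realpow flip: powr_add)
    finally have "2 ^ N * q powr W \<le> (B * q powr e) * q powr W" by (simp add: mult_ac)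
    then have "2 ^ N \<le> B * q powr e" using q by simp
    also have "q powr e = ((1/2) powr e) ^ k"
      by (simp add: q_def powr_power powr_powr mult.commute flip: powr_realpow)
    finally show ?thesis .
  qed
  moreover have "(1/2::real) powr e < 1" using e by (simp add: powr_def ln_div)
  \<comment> \<open>\<open>B + 1\<close> replaces \<open>B\<close> as a divisor because
    \<open>B\<close> may be 0.\<close>
  then obtain k where "((1/2::real) powr e) ^ k < 2 ^ N / (B + 1)"
    using real_arch_pow_inv[of "2 ^ N / (B + 1)" "(1/2) powr e"] B(1) by auto
  then have "(B + 1) * ((1/2) powr e) ^ k < 2 ^ N"
    using B(1) by (simp add: field_simps)
  moreover have "B * ((1/2) powr e) ^ k \<le> (B + 1) * ((1/2) powr e) ^ k"
    by (intro mult_right_mono) auto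
  ultimately show False by (meson not_le order_trans)
qed

subsection \<open>Reduction to boundedly many monomials\<close>

text \<open>Gaussian elimination: a pivot \<open>r\<close> clears coordinate \<open>N\<close> from
  the other vectors, and a relation among those lifts back by choosing the coefficient of
  \<open>r\<close> so that coordinate \<open>N\<close> cancels.\<close>

lemma exists_linear_relation:
  fixes f :: "'a \<Rightarrow> nat \<Rightarrow> real"
  assumes "finite S" "card S > N"
  shows "\<exists>u. (\<exists>s\<in>S. u s \<noteq> 0) \<and> (\<forall>i<N. (\<Sum>s\<in>S. u s * f s i) = 0)"
  using assms
proof (induction N arbitrary: S f)
  case 0
  then have "S \<noteq> {}" by auto
  then show ?case by (intro exI[of _ "\<lambda>_. 1"]) auto
next
  case (Suc N)
  show ?case
  proof (cases "\<forall>s\<in>S. f s N = 0")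
    case True
    from Suc.IH[OF Suc.prems(1), of f] Suc.prems(2)
    obtain u where "\<exists>s\<in>S. u s \<noteq> 0" "\<forall>i<N. (\<Sum>s\<in>S. u s * f s i) = 0" by auto
    with True show ?thesis by (intro exI[of _ u]) (auto simp: less_Suc_eq)
  next
    case False
    then obtain r where r: "r \<in> S" "f r N \<noteq> 0" by auto
    let ?S = "S - {r}"
    have "card ?S > N" using Suc.prems r by simp
    from Suc.IH[OF _ this, of "\<lambda>s i. f s i - f s N / f r N * f r i"] Suc.prems(1)
    obtain u where u: "\<exists>s\<in>?S. u s \<noteq> 0"
      "\<forall>i<N. (\<Sum>s\<in>?S. u s * (f s i - f s N / f r N * f r i)) = 0" by auto
    let ?v = "u(r := - (\<Sum>s\<in>?S. u s * f s N) / f r N)"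
    have "(\<Sum>s\<in>S. ?v s * f s i) = 0" if "i < Suc N" for i
    proof -
      have "(\<Sum>s\<in>S. ?v s * f s i) = ?v r * f r i + (\<Sum>s\<in>?S. u s * f s i)"
        using Suc.prems(1) r by (subst sum.remove[of S r]) (auto intro!: sum.cong)
      also have "\<dots> = (\<Sum>s\<in>?S. u s * (f s i - f s N / f r N * f r i))"
        using r by (simp add: right_diff_distrib sum_subtractf sum_distrib_left sum_divide_distrib mult_ac)
      also have "\<dots> = 0"
        using u(2) r that by (cases "i = N") auto
      finally show ?thesis .
    qed
    moreover have "\<exists>s\<in>S. ?v s \<noteq> 0" using u(1) by auto
    ultimately show ?thesis by blast
  qed
qed

text \<open>This is Helly's theorem, proved via Radon partitions; the library version fixes the dimension
  by a type, whereas here it is a number.\<close>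

lemma infeasible_subset:
  fixes p :: "'a \<Rightarrow> nat \<Rightarrow> real" and v :: real
  assumes fin: "finite M"
    and inf: "\<nexists>w. (\<forall>i<N. w i \<ge> 0) \<and> (\<forall>m\<in>M. (\<Sum>i<N. w i * p m i) \<ge> 1) \<and> (\<Sum>i<N. w i) < v"
  obtains T where "T \<subseteq> M" "card T \<le> N + 1"
    "\<nexists>w. (\<forall>i<N. w i \<ge> 0) \<and> (\<forall>m\<in>T. (\<Sum>i<N. w i * p m i) \<ge> 1) \<and> (\<Sum>i<N. w i) < v"
proof -
  define feas where "feas = (\<lambda>T w. (\<forall>i<N. w i \<ge> 0) \<and> (\<forall>m\<in>T. (\<Sum>i<N. w i * p m i) \<ge> 1) \<and>
    (\<Sum>i<N. w i) < v)"
  let ?Q = "\<lambda>T. T \<subseteq> M \<and> (\<nexists>w. feas T w)"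
  have "?Q M" using inf by (auto simp: feas_def)
  from ex_has_least_nat[of ?Q, OF this, of card]
  obtain T where T: "?Q T" and least: "\<And>T'. ?Q T' \<Longrightarrow> card T \<le> card T'" by blast
  have finT: "finite T" using T fin finite_subset by blast
  have "card T \<le> N + 1"
  proof (rule ccontr)
    assume "\<not> card T \<le> N + 1"
    then have big: "card T > Suc N" by simp
    \<comment> \<open>By minimality of \<open>T\<close>, dropping any one constraint makes the
      system feasible; the solutions \<open>W t\<close> are the points for the Radon
      partition.\<close>
    have "\<exists>w. feas (T - {t}) w" if "t \<in> T" for t
    proof (rule ccontr)
      assume "\<nexists>w. feas (T - {t}) w"
      with T have "?Q (T - {t})" by blast
      from least[OF this] that finT show False
        by (metis card_Diff1_less not_le)
    qed
    then obtain W where W: "\<And>t. t \<in> T \<Longrightarrow> feas (T - {t}) (W t)" by metis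
    \<comment> \<open>The extra coordinate, constantly 1, makes the coefficients sum to 0, so the
      relation is an affine dependence.\<close>
    from exists_linear_relation[OF finT big, of "\<lambda>t i. if i < N then W t i else 1"]
    obtain u where u: "\<exists>t\<in>T. u t \<noteq> 0"
      "\<And>i. i < Suc N \<Longrightarrow> (\<Sum>t\<in>T. u t * (if i < N then W t i else 1)) = 0" by blast
    define P where "P = (\<lambda>t. max (u t) 0)"
    define Q where "Q = (\<lambda>t. max (- u t) 0)"
    have PQ: "u t = P t - Q t" for t by (auto simp: P_def Q_def)
    have W_eq: "(\<Sum>t\<in>T. P t * W t i) = (\<Sum>t\<in>T. Q t * W t i)" if "i < N" for i
      using u(2)[of i] that by (simp add: PQ left_diff_distrib sum_subtractf)
    define L where "L = (\<Sum>t\<in>T. P t)"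
    have L_eq: "L = (\<Sum>t\<in>T. Q t)"
      using u(2)[of N] by (simp add: PQ sum_subtractf L_def)
    have L_pos: "L > 0"
    proof (rule ccontr)
      assume "\<not> L > 0"
      moreover have "L \<ge> 0" by (auto simp: L_def P_def intro: sum_nonneg)
      ultimately have "(\<Sum>t\<in>T. P t) = 0" "(\<Sum>t\<in>T. Q t) = 0" using L_eq by (auto simp: L_def)
      then have "\<forall>t\<in>T. P t = 0" "\<forall>t\<in>T. Q t = 0"
        using finT by (auto simp: sum_nonneg_eq_0_iff P_def Q_def)
      with u(1) show False by (auto simp: PQ)
    qed
    \<comment> \<open>The Radon point: a convex combination of the \<open>W t\<close> with
      \<open>u t > 0\<close> and equally of those with \<open>u t < 0\<close>.\<close>
    define z where "z = (\<lambda>i. (\<Sum>t\<in>T. P t * W t i) / L)"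
    have z_Q: "z i = (\<Sum>t\<in>T. Q t * W t i) / L" if "i < N" for i
      using W_eq[OF that] by (simp add: z_def)
    \<comment> \<open>\<open>R\<close> will be \<open>P\<close> or \<open>Q\<close>, whichever
      vanishes at \<open>m\<close>. Every \<open>W t\<close> with \<open>t \<noteq> m\<close>
      satisfies constraint \<open>m\<close>, hence so does their average \<open>z\<close>.\<close>
    have constraint: "(\<Sum>i<N. z i * p m i) \<ge> 1"
      if m: "m \<in> T" and R: "\<And>t. R t \<ge> 0" "(\<Sum>t\<in>T. R t) = L" "R m = 0"
        and z: "\<And>i. i < N \<Longrightarrow> z i = (\<Sum>t\<in>T. R t * W t i) / L" for m R
    proof -
      have "L \<le> (\<Sum>t\<in>T. R t * (\<Sum>i<N. W t i * p m i))"
        unfolding R(2)[symmetric]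
      proof (rule sum_mono)
        fix t assume t: "t \<in> T"
        show "R t \<le> R t * (\<Sum>i<N. W t i * p m i)"
        proof (cases "t = m")
          case False
          then have "(\<Sum>i<N. W t i * p m i) \<ge> 1" using W[OF t] m by (auto simp: feas_def)
          from mult_left_mono[OF this R(1)[of t]] show ?thesis by simp
        qed (use R in simp)
      qed
      also have "\<dots> = (\<Sum>i<N. (\<Sum>t\<in>T. R t * W t i) * p m i)"
        unfolding sum_distrib_left sum_distrib_right by (subst sum.swap) (simp add: mult_ac)
      also have "\<dots> = L * (\<Sum>i<N. z i * p m i)"
        unfolding sum_distrib_left using z L_pos by (intro sum.cong) auto
      finally show ?thesis using L_pos by simp
    qed
    have "feas T z"
      unfolding feas_def
    proof (intro conjI allI impI ballI)
      show "z i \<ge> 0" if "i < N" for i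
        unfolding z_def using L_pos W that
        by (intro divide_nonneg_pos sum_nonneg mult_nonneg_nonneg) (auto simp: P_def feas_def)
    next
      fix m assume m: "m \<in> T"
      show "(\<Sum>i<N. z i * p m i) \<ge> 1"
      proof (cases "u m \<le> 0")
        case True
        then show ?thesis by (intro constraint[OF m, of P]) (auto simp: P_def L_def z_def)
      next
        case False
        then show ?thesis by (intro constraint[OF m, of Q]) (auto simp: Q_def L_eq z_Q)
      qed
    next
      \<comment> \<open>One positive coefficient suffices to keep the inequality strict under
        averaging.\<close>
      obtain t where t: "t \<in> T" "P t > 0"
        using L_pos unfolding L_def by (meson not_le sum_nonpos)
      have "(\<Sum>t\<in>T. P t * (v - (\<Sum>i<N. W t i))) > 0"
        by (rule sum_pos2[OF finT t(1)])
           (use t W in \<open>auto simp: feas_def P_def less_imp_le intro!: mult_pos_pos mult_nonneg_nonneg\<close>)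
      also have "(\<Sum>t\<in>T. P t * (v - (\<Sum>i<N. W t i))) = L * v - (\<Sum>t\<in>T. P t * (\<Sum>i<N. W t i))"
        by (simp add: right_diff_distrib sum_subtractf L_def sum_distrib_right)
      also have "(\<Sum>t\<in>T. P t * (\<Sum>i<N. W t i)) = L * (\<Sum>i<N. z i)"
        unfolding z_def sum_distrib_left using L_pos by (subst sum.swap) (simp add: sum_divide_distrib sum_distrib_left)
      finally show "(\<Sum>i<N. z i) < v" using L_pos by (simp flip: right_diff_distrib add: zero_less_mult_iff)
    qed
    with T show False by blast
  qed
  with T that show ?thesis by (auto simp: feas_def)
qed

section \<open>Dickson's lemma and uniform certificates\<close>

text \<open>Dickson's lemma in sequence form. The coordinates are treated one after another; a
  decreasing sequence of naturals is eventually constant, so a tail of it is monotone.\<close>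

lemma monotone_subsequence_finite_index:
  fixes f :: "nat \<Rightarrow> 'i \<Rightarrow> nat"
  assumes "finite I"
  shows "\<exists>r :: nat \<Rightarrow> nat. strict_mono r \<and> (\<forall>i\<in>I. mono (\<lambda>j. f (r j) i))"
  using assms
proof (induction I rule: finite_induct)
  case empty
  show ?case by (rule exI[of _ "\<lambda>j. j"]) (simp add: strict_mono_def)
next
  case (insert i I)
  then obtain r :: "nat \<Rightarrow> nat" where r: "strict_mono r" "\<forall>i\<in>I. mono (\<lambda>j. f (r j) i)" by blast
  obtain q where q: "strict_mono q" "monoseq (\<lambda>j. f (r (q j)) i)"
    using seq_monosub[of "\<lambda>j. f (r j) i"] by (auto simp: o_def)
  obtain c where "mono (\<lambda>j. f (r (q (j + c))) i)"
  proof (cases "mono (\<lambda>j. f (r (q j)) i)")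
    case True
    then show ?thesis using that[of 0] by simp
  next
    case False
    with q(2) have dec: "\<And>m n. m \<le> n \<Longrightarrow> f (r (q n)) i \<le> f (r (q m)) i"
      by (auto simp: monoseq_def mono_def)
    \<comment> \<open>\<open>c\<close> is an index where the minimum is attained; from there on the
      decreasing sequence stays constant.\<close>
    obtain c where c: "\<And>j. f (r (q c)) i \<le> f (r (q j)) i"
      using ex_has_least_nat[of "\<lambda>_. True" 0 "\<lambda>j. f (r (q j)) i"] by auto
    have "f (r (q (j + c))) i = f (r (q c)) i" for j
      using c[of "j + c"] dec[of c "j + c"] by simp
    then show ?thesis using that[of c] by (simp add: mono_def)
  qed
  moreover have "strict_mono (\<lambda>j. r (q (j + c)))"
    using r(1) q(1) by (simp add: strict_mono_def)
  moreover have "mono (\<lambda>j. f (r (q (j + c))) k)" if "k \<in> I" for k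
    using r(2) that strict_mono_mono[OF q(1)] by (auto simp: mono_def)
  ultimately show ?case by (intro exI[of _ "\<lambda>j. r (q (j + c))"]) auto
qed

text \<open>An enumeration is padded by repeating its last element, so that all certificates get the
  same number of exponent vectors and can be compared entry by entry.\<close>

lemma finite_set_as_image_lessThan:
  assumes "finite T" "T \<noteq> {}" "card T \<le> K"
  obtains t :: "nat \<Rightarrow> 'a" where "t ` {..<K} = T"
proof -
  obtain h where h: "bij_betw h {0..<card T} T"
    using ex_bij_betw_nat_finite[OF assms(1)] by blast
  have pos: "card T > 0" using assms by (simp add: card_gt_0_iff)
  have "(\<lambda>j. h (min j (card T - 1))) ` {..<K} = T"
  proof
    show "(\<lambda>j. h (min j (card T - 1))) ` {..<K} \<subseteq> T"
      using pos bij_betwE[OF h] by auto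
    show "T \<subseteq> (\<lambda>j. h (min j (card T - 1))) ` {..<K}"
    proof
      fix x assume "x \<in> T"
      then obtain j where "j < card T" "x = h j"
        using bij_betw_imp_surj_on[OF h] by (metis atLeastLessThan_iff imageE)
      then show "x \<in> (\<lambda>j. h (min j (card T - 1))) ` {..<K}"
        using assms(3) by (intro image_eqI[of _ _ j]) (auto simp: min_def)
    qed
  qed
  then show ?thesis by (rule that)
qed

text \<open>Optimality of the weights, normalised by \<open>d\<close>, says that the linear program
  of all monomials of \<open>F\<close> has no solution below \<open>A / d\<close>; Helly's theorem
  keeps this with at most \<open>N + 1\<close> of them. The normalised constraints no longer mention
  \<open>d\<close>, so solutions can be carried between different degrees.\<close>

lemma quasi_smooth_certificate:
  assumes qs: "contains_quasi_smooth_hypersurface a d" and N: "length a = N"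
    and A: "A = (\<Sum>i<N. a ! i)" "0 < A" "A < d"
  shows "\<exists>p :: nat \<Rightarrow> nat \<Rightarrow> nat. (\<forall>j\<le>N. (\<Sum>i<N. a ! i * p j i) = d) \<and>
    (\<forall>w :: nat \<Rightarrow> real. (\<forall>i<N. w i \<ge> 0) \<longrightarrow> (\<forall>j\<le>N. (\<Sum>i<N. w i * p j i) \<ge> 1) \<longrightarrow>
       real A / d \<le> (\<Sum>i<N. w i))"
proof -
  obtain F where F: "weighted_homogeneous a d F" "smooth_away_from_origin (length a) F"
    using qs unfolding contains_quasi_smooth_hypersurface_def by blast
  have d: "real d > 0" using A by simp
  have "\<not> (\<exists>w :: nat \<Rightarrow> real. (\<forall>i<N. w i \<ge> 0) \<and> (\<forall>m\<in>Poly_Mapping.keys F. (\<Sum>i<N. w i * Poly_Mapping.lookup m i) \<ge> 1) \<and>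
      (\<Sum>i<N. w i) < real A / d)"
  proof
    assume "\<exists>w :: nat \<Rightarrow> real. (\<forall>i<N. w i \<ge> 0) \<and> (\<forall>m\<in>Poly_Mapping.keys F. (\<Sum>i<N. w i * Poly_Mapping.lookup m i) \<ge> 1) \<and>
      (\<Sum>i<N. w i) < real A / d"
    then obtain w :: "nat \<Rightarrow> real" where w: "\<forall>i<N. w i \<ge> 0" "\<forall>m\<in>Poly_Mapping.keys F. (\<Sum>i<N. w i * Poly_Mapping.lookup m i) \<ge> 1"
      "(\<Sum>i<N. w i) < real A / d" by blast
    have "real A \<le> (\<Sum>i<N. real d * w i)"
      unfolding A(1) N[symmetric]
    proof (rule weight_sum_minimal[OF F])
      show "(\<Sum>i<length a. a ! i) < d" using A N by simp
      show "real d * w i \<ge> 0" if "i < length a" for i using w(1) that by (simp add: N)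
      show "real d \<le> (\<Sum>i<length a. real d * w i * Poly_Mapping.lookup m i)" if "m \<in> Poly_Mapping.keys F" for m
      proof -
        have "real d * 1 \<le> d * (\<Sum>i<N. w i * Poly_Mapping.lookup m i)"
          using w(2) that by (intro mult_left_mono) auto
        then show ?thesis by (simp add: sum_distrib_left mult.assoc N)
      qed
    qed
    with w(3) d show False by (simp add: field_simps flip: sum_distrib_left)
  qed
  then obtain T where T: "T \<subseteq> Poly_Mapping.keys F" "card T \<le> N + 1"
    "\<nexists>w :: nat \<Rightarrow> real. (\<forall>i<N. w i \<ge> 0) \<and> (\<forall>m\<in>T. (\<Sum>i<N. w i * Poly_Mapping.lookup m i) \<ge> 1) \<and> (\<Sum>i<N. w i) < real A / d"
    using infeasible_subset[of "Poly_Mapping.keys F" N "\<lambda>m i. Poly_Mapping.lookup m i" "real A / d"] by auto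
  have minimal: "real A / d \<le> (\<Sum>i<N. w i)"
    if "\<forall>i<N. w i \<ge> 0" "\<forall>m\<in>T. (\<Sum>i<N. w i * Poly_Mapping.lookup m i) \<ge> 1" for w :: "nat \<Rightarrow> real"
    using T(3) that by (meson not_le)
  have "T \<noteq> {}"
  proof
    assume "T = {}"
    \<comment> \<open>Without constraints \<open>w = 0\<close> would be feasible.\<close>
    then have "real A / d \<le> 0" using minimal[of "\<lambda>_. 0"] by simp
    moreover have "real A / d > 0" using A(2) d by simp
    ultimately show False by simp
  qed
  moreover have "finite T" using T(1) by (rule finite_subset) simp
  ultimately obtain t where t: "t ` {..<N + 1} = T"
    using finite_set_as_image_lessThan T(2) by blast
  have in_T: "t j \<in> T" if "j \<le> N" for j
    using t that by auto
  show ?thesis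
  proof (intro exI[of _ "\<lambda>j i. Poly_Mapping.lookup (t j) i"] conjI allI impI)
    fix j assume "j \<le> N"
    then have m: "t j \<in> Poly_Mapping.keys F" using in_T T(1) by blast
    then have "Poly_Mapping.keys (t j) \<subseteq> {..<N}"
      using F(1) by (auto simp: weighted_homogeneous_def in_variables_def N)
    then have "(\<Sum>i<N. a ! i * Poly_Mapping.lookup (t j) i) =
        (\<Sum>i\<in>Poly_Mapping.keys (t j). a ! i * Poly_Mapping.lookup (t j) i)"
      by (intro sum.mono_neutral_right) (auto simp: in_keys_iff)
    also have "\<dots> = d" using F(1) m by (simp add: weighted_homogeneous_def)
    finally show "(\<Sum>i<N. a ! i * Poly_Mapping.lookup (t j) i) = d" .
  next
    fix w :: "nat \<Rightarrow> real"
    assume w: "\<forall>i<N. w i \<ge> 0" "\<forall>j\<le>N. (\<Sum>i<N. w i * Poly_Mapping.lookup (t j) i) \<ge> 1"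
    have "(\<Sum>i<N. w i * Poly_Mapping.lookup m i) \<ge> 1" if "m \<in> T" for m
    proof -
      have "m \<in> t ` {..<N + 1}" using that t by simp
      then obtain j where "j \<le> N" "m = t j" by (auto simp: less_Suc_eq_le)
      then show ?thesis using w(2) by simp
    qed
    with w(1) show "real A / d \<le> (\<Sum>i<N. w i)" by (intro minimal) auto
  qed
qed

section \<open>Finiteness of the set of weights\<close>

theorem corollary18:
  fixes n k :: nat
  assumes "n \<ge> 1" and "k > 0"
  shows "finite {a :: nat list. length a = n + 1 \<and> (\<forall>i \<le> n. a ! i > 0) \<and>
           well_formed_weights a \<and>
           contains_quasi_smooth_hypersurface a ((\<Sum>i\<le>n. a ! i) + k)}"
    (is "finite ?S")
proof (rule ccontr)
  assume inf: "infinite ?S"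
  define N where "N = n + 1"
  define A where "A = (\<lambda>a :: nat list. \<Sum>i<N. a ! i)"
  have sum_eq: "(\<Sum>i\<le>n. a ! i) = A a" for a
    by (simp add: A_def N_def lessThan_Suc_atMost)
  define S where "S = ?S"
  have S: "length a = N" "a ! 0 > 0" "contains_quasi_smooth_hypersurface a (A a + k)" if "a \<in> S" for a
    using that by (simp_all add: S_def N_def sum_eq)
  have infS: "infinite S" using inf by (simp add: S_def)
  \<comment> \<open>A bound on the sums bounds every entry, and lists of fixed length with bounded
    entries are finite in number.\<close>
  have infA: "infinite (A ` S)"
  proof
    assume "finite (A ` S)"
    then obtain D where D: "\<And>a. a \<in> S \<Longrightarrow> A a \<le> D"
      unfolding finite_nat_set_iff_bounded_le by blast
    have "S \<subseteq> {xs. set xs \<subseteq> {..D} \<and> length xs = N}"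
    proof
      fix a assume a: "a \<in> S"
      then have len: "length a = N" by (rule S)
      have "a ! i \<le> D" if "i < N" for i
      proof -
        have "a ! i \<le> A a" unfolding A_def using that by (intro member_le_sum) auto
        then show ?thesis using D[OF a] by simp
      qed
      with len show "a \<in> {xs. set xs \<subseteq> {..D} \<and> length xs = N}"
        by (auto simp: in_set_conv_nth)
    qed
    moreover have "finite {xs. set xs \<subseteq> {..D} \<and> length xs = N}"
      by (rule finite_lists_length_eq) simp
    ultimately show False using infS finite_subset by blast
  qed
  \<comment> \<open>This selects a sequence of weights with strictly increasing sums.\<close>
  define e where "e = enumerate (A ` S)"
  have e: "strict_mono e"
    unfolding e_def by (rule strict_monoI) (rule enumerate_mono[OF _ infA])
  have "\<forall>j. \<exists>a. a \<in> S \<and> A a = e j"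
  proof
    fix j
    have "e j \<in> A ` S" unfolding e_def by (rule enumerate_in_set[OF infA])
    then show "\<exists>a. a \<in> S \<and> A a = e j" by auto
  qed
  from choice[OF this] obtain a where a: "\<And>j. a j \<in> S" "\<And>j. A (a j) = e j" by blast
  define d where "d = (\<lambda>j. e j + k)"
  have len: "length (a j) = N" for j by (rule S[OF a(1)])
  have "\<exists>p :: nat \<Rightarrow> nat \<Rightarrow> nat. (\<forall>l\<le>N. (\<Sum>i<N. a j ! i * p l i) = d j) \<and>
    (\<forall>w :: nat \<Rightarrow> real. (\<forall>i<N. w i \<ge> 0) \<longrightarrow> (\<forall>l\<le>N. (\<Sum>i<N. w i * p l i) \<ge> 1) \<longrightarrow>
       real (e j) / d j \<le> (\<Sum>i<N. w i))" for j
  proof -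
    have "contains_quasi_smooth_hypersurface (a j) (d j)"
      using S(3)[OF a(1)[of j]] a(2)[of j] by (simp add: d_def)
    moreover have "e j = (\<Sum>i<N. a j ! i)" using a(2)[of j] by (simp add: A_def)
    moreover have "0 < e j"
    proof -
      have "0 < a j ! 0" by (rule S[OF a(1)])
      also have "\<dots> \<le> A (a j)" unfolding A_def by (intro member_le_sum) (auto simp: N_def)
      finally show ?thesis by (simp add: a(2))
    qed
    moreover have "e j < d j" using assms(2) by (simp add: d_def)
    ultimately show ?thesis
      by (rule quasi_smooth_certificate[OF _ len])
  qed
  then have "\<forall>j. \<exists>p :: nat \<Rightarrow> nat \<Rightarrow> nat. (\<forall>l\<le>N. (\<Sum>i<N. a j ! i * p l i) = d j) \<and>
    (\<forall>w :: nat \<Rightarrow> real. (\<forall>i<N. w i \<ge> 0) \<longrightarrow> (\<forall>l\<le>N. (\<Sum>i<N. w i * p l i) \<ge> 1) \<longrightarrow>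
       real (e j) / d j \<le> (\<Sum>i<N. w i))" ..
  from choice[OF this] obtain p :: "nat \<Rightarrow> nat \<Rightarrow> nat \<Rightarrow> nat" where p: "\<And>j l. l \<le> N \<Longrightarrow> (\<Sum>i<N. a j ! i * p j l i) = d j"
    "\<And>j (w :: nat \<Rightarrow> real). (\<forall>i<N. w i \<ge> 0) \<Longrightarrow> (\<forall>l\<le>N. (\<Sum>i<N. w i * p j l i) \<ge> 1) \<Longrightarrow>
       real (e j) / d j \<le> (\<Sum>i<N. w i)"
    by blast
  obtain r :: "nat \<Rightarrow> nat" where r: "strict_mono r"
    "\<forall>x\<in>{..N} \<times> {..<N}. mono (\<lambda>j. case x of (l, i) \<Rightarrow> p (r j) l i)"
    using monotone_subsequence_finite_index[of "{..N} \<times> {..<N}" "\<lambda>j x. case x of (l, i) \<Rightarrow> p j l i"] by auto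
  have p_le: "p (r 0) l i \<le> p (r 1) l i" if "l \<le> N" "i < N" for l i
    using r(2) that by (auto simp: mono_def dest: bspec[of _ _ "(l, i)"])
  have lt: "e (r 0) < e (r 1)"
    using r(1) e by (simp add: strict_mono_def)
  have d_pos: "real (d j) > 0" for j using assms(2) by (simp add: d_def)
  \<comment> \<open>The normalised weights of the earlier member are tested in the later
    certificate: they give its own exponent vectors the value 1, hence the dominating later ones at
    least 1.\<close>
  define w where "w = (\<lambda>i. real (a (r 0) ! i) / d (r 0))"
  have "real (e (r 1)) / d (r 1) \<le> (\<Sum>i<N. w i)"
  proof (rule p(2), intro allI impI)
    show "w i \<ge> 0" for i by (simp add: w_def)
  next
    show "\<forall>l\<le>N. (\<Sum>i<N. w i * p (r 1) l i) \<ge> 1"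
    proof (intro allI impI)
      fix l assume l: "l \<le> N"
      have "real (d (r 0)) = (\<Sum>i<N. real (a (r 0) ! i) * p (r 0) l i)"
        using p(1)[OF l, of "r 0"] by (simp flip: of_nat_mult of_nat_sum)
      also have "\<dots> \<le> (\<Sum>i<N. real (a (r 0) ! i) * p (r 1) l i)"
        using p_le[OF l] by (intro sum_mono mult_left_mono) auto
      also have "\<dots> = d (r 0) * (\<Sum>i<N. w i * p (r 1) l i)"
        using d_pos[of "r 0"] by (simp add: w_def sum_distrib_left)
      finally show "(\<Sum>i<N. w i * p (r 1) l i) \<ge> 1"
        using d_pos[of "r 0"] by simp
    qed
  qed
  also have "(\<Sum>i<N. w i) = real (e (r 0)) / d (r 0)"
    using a(2)[of "r 0"] by (simp add: w_def A_def flip: sum_divide_distrib of_nat_sum)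
  finally have "real (e (r 1)) * d (r 0) \<le> real (e (r 0)) * d (r 1)"
    using d_pos[of "r 0"] d_pos[of "r 1"] by (simp add: field_simps)
  \<comment> \<open>Since \<open>d j = e j + k\<close>, the products
    \<open>e (r 0) * e (r 1)\<close> cancel; this is the strict growth of \<open>x / (x + k)\<close>
    in cross-multiplied form.\<close>
  then have "real (e (r 1)) * k \<le> real (e (r 0)) * k"
    by (simp add: d_def algebra_simps)
  with lt assms(2) show False by simp
qed

end
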